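(* Let $p$ be a prime and $x$ a $p$-adic integer, and let $s_k(x)=\sum_{i=0}^k\binom{k}{i}\binom{x}{i}\binom{x+i}{i}$. Then $$\sum_{k=0}^{p-1}(2k+1)s_k(x)^2\equiv p^2\sum_{k=0}^{p-1}\frac{(-1)^k}{k+1}\binom{x+k}{2k}\sum_{j=0}^{k}\binom{2k}{j+k}\binom{x}{j}\binom{x+j}{j}\pmod{p^4}.$$
   Context: Here $\binom{x}{i}=x(x-1)\cdots(x-i+1)/i!$ for a $p$-adic integer $x$. *)

theory Defs
  imports
    "HOL-Computational_Algebra.Polynomial_Factorial"
    "Berlekamp_Zassenhaus.Finite_Field"
begin

text \<open>
  The ring of \<open>p\<close>-adic integers as the inverse limit of the rings \<open>\<int>/p\<^sup>n\<int>\<close>. The prime is the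
  cardinality of the index type, \<open>p = CARD('p)\<close>; the residue class modulo \<open>p\<^sup>n\<close> is represented
  by its least nonnegative element.
\<close>

typedef (overloaded) ('p :: prime_card) padic_int =
  "{f :: nat \<Rightarrow> int. \<forall>n. f n \<in> {0..<int CARD('p) ^ n} \<and> f (Suc n) mod int CARD('p) ^ n = f n}"
  morphisms padic_residue Abs_padic_int
proof
  show "(\<lambda>_. 0) \<in> {f :: nat \<Rightarrow> int. \<forall>n. f n \<in> {0..<int CARD('p) ^ n} \<and>
      f (Suc n) mod int CARD('p) ^ n = f n}"
    using prime_gt_0_nat[OF prime_card[where 'a = 'p]] by simp
qed

setup_lifting type_definition_padic_int

lemma CARD_prime_pos [simp]: "0 < int CARD('p :: prime_card)"
  using prime_gt_0_nat[OF prime_card[where 'a = 'p]] by simp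

lemma CARD_prime_power_pos [simp]: "0 < int CARD('p :: prime_card) ^ n"
  by (rule zero_less_power) simp

lemma padic_coherent_mod:
  fixes f :: "nat \<Rightarrow> int"
  assumes "\<And>n. f (Suc n) mod q ^ n = f n"
  shows "f (n + k) mod q ^ n = f n"
proof (induction k)
  case 0
  show ?case by (metis add.right_neutral assms mod_mod_trivial)
next
  case (Suc k)
  have "f (n + Suc k) mod q ^ n = f (Suc (n + k)) mod q ^ (n + k) mod q ^ n"
    by (simp add: mod_mod_cancel le_imp_power_dvd)
  also have "\<dots> = f n" using Suc assms[of "n + k"] by simp
  finally show ?case .
qed

lemma padic_op1_coherent:
  fixes q :: int
  assumes "f (Suc n) mod q ^ n = f n" and "\<And>a. h (a mod q ^ n) mod q ^ n = h a mod q ^ n"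
  shows "(h (f (Suc n)) mod q ^ Suc n) mod q ^ n = h (f n) mod q ^ n"
proof -
  have "(h (f (Suc n)) mod q ^ Suc n) mod q ^ n = h (f (Suc n)) mod q ^ n"
    by (rule mod_mod_cancel) simp
  then show ?thesis using assms(2)[of "f (Suc n)"] assms(1) by simp
qed

lemma padic_op2_coherent:
  fixes q :: int
  assumes "f (Suc n) mod q ^ n = f n" and "g (Suc n) mod q ^ n = g n"
    and "\<And>a b. h (a mod q ^ n) (b mod q ^ n) mod q ^ n = h a b mod q ^ n"
  shows "(h (f (Suc n)) (g (Suc n)) mod q ^ Suc n) mod q ^ n = h (f n) (g n) mod q ^ n"
proof -
  have "(h (f (Suc n)) (g (Suc n)) mod q ^ Suc n) mod q ^ n = h (f (Suc n)) (g (Suc n)) mod q ^ n"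
    by (rule mod_mod_cancel) simp
  then show ?thesis using assms(3)[of "f (Suc n)" "g (Suc n)"] assms(1,2) by simp
qed

instantiation padic_int :: (prime_card) comm_ring_1
begin

lift_definition zero_padic_int :: "'a padic_int" is "\<lambda>_. 0"
  by simp

lift_definition one_padic_int :: "'a padic_int" is "\<lambda>n. 1 mod int CARD('a) ^ n"
  by (simp add: mod_mod_cancel del: power_Suc) (simp add: mod_mod_cancel)

lift_definition plus_padic_int :: "'a padic_int \<Rightarrow> 'a padic_int \<Rightarrow> 'a padic_int"
  is "\<lambda>f g n. (f n + g n) mod int CARD('a) ^ n"
  using padic_op2_coherent[where h = "(+)"] by (simp add: mod_simps del: power_Suc)

lift_definition minus_padic_int :: "'a padic_int \<Rightarrow> 'a padic_int \<Rightarrow> 'a padic_int"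
  is "\<lambda>f g n. (f n - g n) mod int CARD('a) ^ n"
  using padic_op2_coherent[where h = "(-)"] by (simp add: mod_simps del: power_Suc)

lift_definition uminus_padic_int :: "'a padic_int \<Rightarrow> 'a padic_int"
  is "\<lambda>f n. (- f n) mod int CARD('a) ^ n"
  using padic_op1_coherent[where h = "uminus"] by (simp add: mod_simps del: power_Suc)

lift_definition times_padic_int :: "'a padic_int \<Rightarrow> 'a padic_int \<Rightarrow> 'a padic_int"
  is "\<lambda>f g n. (f n * g n) mod int CARD('a) ^ n"
  using padic_op2_coherent[where h = "(*)"] by (simp add: mod_simps del: power_Suc)

instance
proof
  fix a b c :: "'a padic_int"
  show "a + b + c = a + (b + c)"
    by transfer (simp add: mod_simps add.assoc)
  show "a + b = b + a"
    by transfer (simp add: add.commute)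
  show "0 + a = a"
    by transfer (simp add: fun_eq_iff)
  show "- a + a = 0"
    by transfer (simp add: mod_simps)
  show "a - b = a + - b"
    by transfer (simp add: mod_simps)
  show "a * b * c = a * (b * c)"
    by transfer (simp add: mod_simps mult.assoc)
  show "a * b = b * a"
    by transfer (simp add: mult.commute)
  show "1 * a = a"
    by transfer (simp add: mod_simps fun_eq_iff)
  show "(a + b) * c = a * c + b * c"
    by transfer (simp add: mod_simps distrib_right)
  show "(0 :: 'a padic_int) \<noteq> 1"
  proof
    assume "(0 :: 'a padic_int) = 1"
    then have "1 mod int CARD('a) ^ 1 = 0"
      by transfer (metis)
    then show False
      using prime_gt_1_nat[OF prime_card[where 'a = 'a]] by simp
  qed
qed

end

lemma padic_residue_mod [simp]:
  "padic_residue (x :: 'p padic_int) (n + k) mod int CARD('p :: prime_card) ^ n = padic_residue x n"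
  by (rule padic_coherent_mod) (use padic_residue[of x] in simp)

lemma prime_power_dvd_mult_cases:
  fixes q a b :: int
  assumes "prime q" "q ^ (m + n) dvd a * b"
  shows "q ^ m dvd a \<or> q ^ n dvd b"
proof (cases "a = 0 \<or> b = 0")
  case False
  then have "m + n \<le> multiplicity q (a * b)"
    using assms by (intro multiplicity_geI) auto
  also have "\<dots> = multiplicity q a + multiplicity q b"
    using False assms(1) by (intro prime_elem_multiplicity_mult_distrib) auto
  finally have "m \<le> multiplicity q a \<or> n \<le> multiplicity q b" by linarith
  then show ?thesis by (auto intro: multiplicity_dvd')
qed auto

instance padic_int :: (prime_card) idom
proof
  fix a b :: "'a padic_int"
  assume nz: "a \<noteq> 0" "b \<noteq> 0"
  let ?q = "int CARD('a)"
  obtain m n where mn: "padic_residue a m \<noteq> 0" "padic_residue b n \<noteq> 0"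
    using nz by (auto simp: padic_residue_inject[symmetric] zero_padic_int.rep_eq fun_eq_iff)
  have "\<not> ?q ^ m dvd padic_residue a (m + n)"
    using mn(1) padic_residue_mod[of a m n] by (auto simp: dvd_eq_mod_eq_0)
  moreover have "\<not> ?q ^ n dvd padic_residue b (m + n)"
    using mn(2) padic_residue_mod[of b n m] by (auto simp: dvd_eq_mod_eq_0 add.commute)
  ultimately have "\<not> ?q ^ (m + n) dvd padic_residue a (m + n) * padic_residue b (m + n)"
    using prime_power_dvd_mult_cases[OF prime_card_int[where 'a = 'a]] by blast
  then have "padic_residue (a * b) (m + n) \<noteq> 0"
    by (simp add: times_padic_int.rep_eq dvd_eq_mod_eq_0)
  then show "a * b \<noteq> 0"
    by (auto simp: zero_padic_int.rep_eq)
qed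

lemma padic_residue_of_nat:
  "padic_residue (of_nat k :: 'p :: prime_card padic_int) n = int k mod int CARD('p) ^ n"
  by (induction k)
    (simp_all add: zero_padic_int.rep_eq one_padic_int.rep_eq plus_padic_int.rep_eq mod_simps)

instance padic_int :: (prime_card) ring_char_0
proof
  show "inj (of_nat :: nat \<Rightarrow> 'a padic_int)"
  proof (rule injI)
    fix k l :: nat
    assume eq: "(of_nat k :: 'a padic_int) = of_nat l"
    let ?q = "int CARD('a)"
    obtain n where n: "max (int k) (int l) < ?q ^ n"
      using real_arch_pow[of "real CARD('a)" "real (max k l)"]
        prime_gt_1_nat[OF prime_card[where 'a = 'a]]
      by (metis of_int_less_iff of_int_of_nat_eq of_int_power of_nat_1 of_nat_less_iff of_nat_max)
    have "int k mod ?q ^ n = int l mod ?q ^ n"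
      using eq by (metis padic_residue_of_nat)
    then show "k = l" using n by simp
  qed
qed

instance fract :: ("{idom, ring_char_0}") field_char_0
proof
  show "inj (of_nat :: nat \<Rightarrow> 'a fract)"
    by (rule injI) (simp add: of_nat_fract eq_fract)
qed

text \<open>The field of \<open>p\<close>-adic numbers; \<open>to_fract\<close> embeds the \<open>p\<close>-adic integers into it.\<close>

type_synonym 'p padic = "'p padic_int fract"

text \<open>Congruence of \<open>p\<close>-adic numbers modulo \<open>m\<close>: the difference lies in \<open>m \<int>\<^sub>p\<close>.\<close>

definition padic_cong :: "'p :: prime_card padic \<Rightarrow> 'p padic \<Rightarrow> nat \<Rightarrow> bool" where
  "padic_cong a b m \<longleftrightarrow> (\<exists>z :: 'p padic_int. a - b = of_nat m * to_fract z)"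

definition s_sum :: "nat \<Rightarrow> 'a :: field_char_0 \<Rightarrow> 'a" where
  "s_sum k x = (\<Sum>i=0..k. of_nat (k choose i) * (x gchoose i) * ((x + of_nat i) gchoose i))"

end

theory Submission
  imports Defs
begin

text \<open>
  Put \<open>c\<^sub>j(x) = C(x,j) C(x+j,j)\<close>. The products of these polynomials linearize as
  \<open>c\<^sub>i c\<^sub>j = \<Sum>\<^sub>r C(i+j,r) C(r,i) C(r,j) c\<^sub>r\<close>. Expanding both sides in the \<open>c\<^sub>r(x)\<close>, using Vandermonde
  and the linearization once more at \<open>x = n\<close>, gives
  \<open>s\<^sub>n(x)\<^sup>2 = \<Sum>\<^sub>k c\<^sub>k(n) A\<^sub>k(x)\<close> with \<open>A\<^sub>k(x) = C(x+k,2k) \<Sum>\<^sub>j C(2k,j+k) c\<^sub>j(x)\<close>.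
  The sum over \<open>n < p\<close> with weights \<open>2n+1\<close> is then exactly
  \<open>p\<^sup>2 \<Sum>\<^sub>k C(p-1,k) C(p+k,k) A\<^sub>k(x) / (k+1)\<close>, and
  \<open>C(p-1,k) C(p+k,k) = (-1)\<^sup>k \<Prod>\<^sub>i (1 - p\<^sup>2/i\<^sup>2)\<close> is \<open>(-1)\<^sup>k\<close> modulo \<open>p\<^sup>2\<close>. The only denominator divisible
  by \<open>p\<close> is that of \<open>k = p-1\<close>, where it is compensated by \<open>p\<close> dividing \<open>A\<^sub>k(x)\<close>.
\<close>

section \<open>The square of the sum\<close>

definition legendre_binomial :: "nat \<Rightarrow> 'a :: field_char_0 \<Rightarrow> 'a" where
  "legendre_binomial j x = (x gchoose j) * ((x + of_nat j) gchoose j)"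

lemma legendre_binomial_0 [simp]: "legendre_binomial 0 x = 1"
  by (simp add: legendre_binomial_def)

text \<open>The new factor \<open>(x - j) (x + j + 1)\<close> depends on \<open>x\<close> only
  through \<open>u = x (x + 1)\<close>. Hence these are polynomials of degree \<open>j\<close> in
  \<open>u\<close> with roots \<open>i (i + 1)\<close> for \<open>i < j\<close>.\<close>

lemma legendre_binomial_Suc:
  "of_nat (Suc j) ^ 2 * legendre_binomial (Suc j) x =
     legendre_binomial j x * (x * (x + 1) - of_nat j * of_nat (Suc j))"
proof -
  have 1: "of_nat (Suc j) * (x gchoose Suc j) = (x - of_nat j) * (x gchoose j)"
    using gbinomial_absorb_comp[of x j] gbinomial_absorption[of j "x"]
    by (simp add: gbinomial_mult_1 algebra_simps)
  have 2: "of_nat (Suc j) * ((x + of_nat (Suc j)) gchoose Suc j) =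
     (x + of_nat (Suc j)) * ((x + of_nat j) gchoose j)"
    using gbinomial_absorption[of j "x + of_nat (Suc j)"] by (simp add: add.assoc)
  have "of_nat (Suc j) ^ 2 * legendre_binomial (Suc j) x =
     (of_nat (Suc j) * (x gchoose Suc j)) * (of_nat (Suc j) * ((x + of_nat (Suc j)) gchoose Suc j))"
    by (simp add: legendre_binomial_def power2_eq_square)
  also have "\<dots> = legendre_binomial j x * (x * (x + 1) - of_nat j * of_nat (Suc j))"
    unfolding 1 2 by (simp add: legendre_binomial_def algebra_simps)
  finally show ?thesis .
qed

text \<open>Lets \<open>x\<close> and \<open>n\<close> exchange roles:
  \<open>C(n+k,2k) c_k(x)\<close> and \<open>c_k(n) C(x+k,2k)\<close> agree, both being
  \<open>C(2k,k) C(n+k,2k) C(x+k,2k)\<close>.\<close>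

lemma legendre_binomial_central:
  "legendre_binomial k x = of_nat ((2 * k) choose k) * ((x + of_nat k) gchoose (2 * k))"
  using gbinomial_trinomial_revision[of k "2 * k" "x + of_nat k"]
  by (simp add: legendre_binomial_def binomial_gbinomial mult_ac)

lemma legendre_binomial_of_nat:
  "legendre_binomial k (of_nat n) = of_nat ((n choose k) * ((n + k) choose k))"
  by (simp add: legendre_binomial_def binomial_gbinomial)

section \<open>Linearization of products\<close>

definition linearization_coeff :: "nat \<Rightarrow> nat \<Rightarrow> nat \<Rightarrow> nat" where
  "linearization_coeff i j r = ((i + j) choose r) * (r choose i) * (r choose j)"

lemma of_nat_Suc_times_binomial:
  "of_nat (Suc q) * of_nat (n choose Suc q) = (of_nat n - of_nat q :: 'a :: comm_ring_1) * of_nat (n choose q)"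
proof (cases "q \<le> n")
  case True
  have "Suc q * (n choose Suc q) = (n - q) * (n choose q)"
    by (metis binomial_absorb_comp binomial_absorption mult.commute)
  then have "of_nat (Suc q * (n choose Suc q)) = (of_nat ((n - q) * (n choose q)) :: 'a)"
    by (rule arg_cong)
  then show ?thesis using True by (simp add: of_nat_diff algebra_simps)
qed (simp add: binomial_eq_0)

lemma of_nat_diff_times_binomial_Suc:
  "(of_nat (Suc n) - of_nat m) * of_nat (Suc n choose m) =
     (of_nat (Suc n) * of_nat (n choose m) :: 'a :: comm_ring_1)"
proof (cases m)
  case (Suc l)
  then show ?thesis using of_nat_Suc_times_binomial[of l n, where 'a='a]
    by (simp add: algebra_simps)
qed simp

text \<open>The coefficient comparison needed when the expansion for \<open>i, j\<close> is
  multiplied by \<open>u - j (j + 1)\<close>: index \<open>q\<close> is raised with weight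
  \<open>(q + 1)^2\<close>, index \<open>q + 1\<close> stays with weight
  \<open>(q + 1) (q + 2) - j (j + 1)\<close>.\<close>

lemma linearization_coeff_Suc:
  "(of_nat (Suc j) ^ 2 * of_nat (linearization_coeff i (Suc j) (Suc q)) :: 'a :: comm_ring_1) =
     of_nat (Suc q) ^ 2 * of_nat (linearization_coeff i j q) +
     (of_nat (Suc q) * of_nat (Suc (Suc q)) - of_nat j * of_nat (Suc j)) *
       of_nat (linearization_coeff i j (Suc q))"
proof -
  define X X' Y Y' Z Z' W A Q I J :: 'a where "X = of_nat ((i + j) choose q)" and "X' = of_nat ((i + j) choose Suc q)"
    and "Y = of_nat (Suc q choose i)" and "Y' = of_nat (q choose i)"
    and "Z = of_nat (Suc q choose j)" and "Z' = of_nat (q choose j)"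
    and "W = of_nat (Suc q choose Suc j)"
    and "A = of_nat (Suc (i + j) choose Suc q)"
    and "Q = of_nat q" and "I = of_nat i" and "J = of_nat j"
  note d = this
  have e: "(Q + 1) * X' = (I + J - Q) * X" "(Q + 1) * Y' = (Q + 1 - I) * Y" "(Q + 1) * Z' = (Q + 1 - J) * Z"
    "(J + 1) * W = (Q + 1 - J) * Z" "A = X + X'"
    using of_nat_Suc_times_binomial[of q "i + j", where 'a='a] of_nat_diff_times_binomial_Suc[of q i, where 'a='a]
      of_nat_diff_times_binomial_Suc[of q j, where 'a='a]
      of_nat_Suc_times_binomial[of j "Suc q", where 'a='a]
    unfolding d by (simp_all add: algebra_simps)
  have "(J + 1) ^ 2 * (A * Y * W) = (Q + 1) ^ 2 * (X * Y' * Z') + ((Q + 1) * (Q + 2) - J * (J + 1)) * (X' * Y * Z)"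
  proof -
    have "(J + 1) ^ 2 * (A * Y * W) = (J + 1) * (X + X') * Y * ((J + 1) * W)"
      unfolding e(5) by (simp add: power2_eq_square mult_ac)
    also have "\<dots> = (Q + 1 - J) * Y * Z * ((J + 1) * (X + X'))"
      unfolding e(4) by (simp add: mult_ac)
    \<comment> \<open>The last bracket is zero by \<open>e(1)\<close>. The split makes
      \<open>Q + 1 - I\<close> appear for \<open>e(2)\<close>, and
      \<open>(Q + 1 - J) (Q + J + 2)\<close> equals
      \<open>(Q + 1) (Q + 2) - J (J + 1)\<close>.\<close>
    also have "(J + 1) * (X + X') = (Q + 1 - I) * X + (Q + J + 2) * X' + ((I + J - Q) * X - (Q + 1) * X')"
      by (simp add: algebra_simps)
    also have "\<dots> = (Q + 1 - I) * X + (Q + J + 2) * X'"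
      unfolding e(1) by simp
    also have "(Q + 1 - J) * Y * Z * \<dots> =
      X * ((Q + 1 - I) * Y) * ((Q + 1 - J) * Z) + ((Q + 1) * (Q + 2) - J * (J + 1)) * (X' * Y * Z)"
      by (simp add: algebra_simps)
    also have "\<dots> = (Q + 1) ^ 2 * (X * Y' * Z') + ((Q + 1) * (Q + 2) - J * (J + 1)) * (X' * Y * Z)"
      unfolding e(2,3)[symmetric] by (simp only: power2_eq_square mult_ac)
    finally show ?thesis .
  qed
  then show ?thesis
    unfolding linearization_coeff_def d by (simp add: algebra_simps)
qed

lemma linearization_coeff_eq_0: "r > i + j \<Longrightarrow> linearization_coeff i j r = 0"
  by (simp add: linearization_coeff_def)

lemma linearization_coeff_Suc_0: "linearization_coeff i (Suc j) 0 = 0"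
  by (simp add: linearization_coeff_def)

lemma linearization_coeff_0_right: "linearization_coeff i 0 r = (if r = i then 1 else 0)"
  by (cases r i rule: linorder_cases) (simp_all add: linearization_coeff_def)

text \<open>The linearization is an instance of the Pfaff--Saalschuetz summation.\<close>

lemma legendre_binomial_mult:
  fixes x :: "'a :: field_char_0"
  assumes "i + j \<le> N"
  shows "legendre_binomial i x * legendre_binomial j x =
    (\<Sum>r\<le>N. of_nat (linearization_coeff i j r) * legendre_binomial r x)"
  using assms
proof (induction j arbitrary: N)
  case 0
  then show ?case
    by (simp add: linearization_coeff_0_right if_distrib[of of_nat] if_distribR
        if_distrib[of "\<lambda>z. z * _"] sum.delta cong: if_cong)
next
  case (Suc j)
  then obtain M where N: "N = Suc M" and M: "i + j \<le> M" by (cases N) auto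
  define u where "u = x * (x + 1)"
  let ?l = "\<lambda>r. of_nat (linearization_coeff i j r) :: 'a" and ?c = "\<lambda>r. legendre_binomial r x"
  have "of_nat (Suc j) ^ 2 * (?c i * ?c (Suc j)) = ?c i * (of_nat (Suc j) ^ 2 * ?c (Suc j))"
    by (simp add: mult_ac)
  also have "\<dots> = (?c i * ?c j) * (u - of_nat j * of_nat (Suc j))"
    unfolding legendre_binomial_Suc u_def by (simp add: mult.assoc)
  also have "\<dots> = (\<Sum>r\<le>M. ?l r * (u * ?c r - of_nat j * of_nat (Suc j) * ?c r))"
    unfolding Suc.IH[OF M] sum_distrib_right by (intro sum.cong refl) (simp only: algebra_simps)
  \<comment> \<open>By the recurrence, \<open>u * ?c r\<close> is \<open>(r + 1)^2\<close> times the
    next basis element plus \<open>r (r + 1)\<close> times \<open>?c r\<close> itself.\<close>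
  also have "\<dots> = (\<Sum>r\<le>M. ?l r * (of_nat (Suc r) ^ 2 * ?c (Suc r) +
       (of_nat r * of_nat (Suc r) - of_nat j * of_nat (Suc j)) * ?c r))"
    unfolding legendre_binomial_Suc u_def[symmetric]
    by (intro sum.cong refl) (simp only: algebra_simps)
  also have "\<dots> = (\<Sum>r\<le>M. ?l r * of_nat (Suc r) ^ 2 * ?c (Suc r)) +
       (\<Sum>r\<le>M. ?l r * (of_nat r * of_nat (Suc r) - of_nat j * of_nat (Suc j)) * ?c r)"
    unfolding sum.distrib[symmetric] by (intro sum.cong refl) (simp only: algebra_simps)
  also have "(\<Sum>r\<le>M. ?l r * (of_nat r * of_nat (Suc r) - of_nat j * of_nat (Suc j)) * ?c r) =
       (\<Sum>r\<le>Suc M. ?l r * (of_nat r * of_nat (Suc r) - of_nat j * of_nat (Suc j)) * ?c r)"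
    using M by (simp add: linearization_coeff_eq_0)
  \<comment> \<open>The term \<open>r = 0\<close> drops out: for \<open>j = 0\<close> its bracket
    vanishes, for \<open>j > 0\<close> its coefficient does.\<close>
  also have "\<dots> = (\<Sum>r\<le>M. ?l (Suc r) * (of_nat (Suc r) * of_nat (Suc (Suc r)) - of_nat j * of_nat (Suc j)) * ?c (Suc r))"
    unfolding sum.atMost_Suc_shift
    by (cases j) (simp_all add: linearization_coeff_Suc_0)
  also have "(\<Sum>r\<le>M. ?l r * of_nat (Suc r) ^ 2 * ?c (Suc r)) + \<dots> =
     (\<Sum>r\<le>M. of_nat (Suc j) ^ 2 * of_nat (linearization_coeff i (Suc j) (Suc r)) * ?c (Suc r))"
    unfolding sum.distrib[symmetric] linearization_coeff_Suc
    by (intro sum.cong refl) (simp only: algebra_simps)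
  also have "\<dots> = of_nat (Suc j) ^ 2 * (\<Sum>r\<le>N. of_nat (linearization_coeff i (Suc j) r) * ?c r)"
    unfolding N sum.atMost_Suc_shift linearization_coeff_Suc_0
    by (simp add: sum_distrib_left mult.assoc)
  finally show ?case
    by (simp only: mult_cancel_left power_eq_0_iff of_nat_eq_0_iff) simp
qed

section \<open>Binomial sums for the square\<close>

lemma sum_binomial_shifted: "(\<Sum>m\<le>N. (N choose m) * (r choose (t + m))) = ((N + r) choose (N + t))"
proof (induction N arbitrary: t)
  case (Suc N)
  \<comment> \<open>Pascal's rule on the first factor; the pieces regroup into the sums for
    \<open>Suc t\<close> and \<open>t\<close>, whose values add up by Pascal's rule again.\<close>
  have "(\<Sum>m\<le>Suc N. (Suc N choose m) * (r choose (t + m))) =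
      (r choose t) + (\<Sum>m\<le>N. (N choose m) * (r choose (t + Suc m))) +
      (\<Sum>m\<le>N. (N choose Suc m) * (r choose (t + Suc m)))"
    unfolding sum.atMost_Suc_shift by (simp add: sum.distrib distrib_right)
  also have "(r choose t) + (\<Sum>m\<le>N. (N choose m) * (r choose (t + Suc m))) +
      (\<Sum>m\<le>N. (N choose Suc m) * (r choose (t + Suc m))) =
      (\<Sum>m\<le>N. (N choose m) * (r choose (Suc t + m))) + (\<Sum>m\<le>Suc N. (N choose m) * (r choose (t + m)))"
    unfolding sum.atMost_Suc_shift by simp
  also have "\<dots> = ((N + r) choose (N + Suc t)) + ((N + r) choose (N + t))"
    by (simp only: sum.atMost_Suc Suc.IH) simp
  finally show ?case by simp
qed simp

text \<open>Trinomial revision pulls out \<open>n choose t\<close> and leaves a shifted Vandermonde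
  sum.\<close>

lemma sum_binomial_three:
  assumes "t \<le> r"
  shows "(\<Sum>i\<le>n. (n choose i) * (i choose t) * (r choose i)) = (n choose t) * ((n + (r - t)) choose n)"
proof (cases "t \<le> n")
  case True
  have "(\<Sum>i\<le>n. (n choose i) * (i choose t) * (r choose i)) =
      (\<Sum>i=0+t..(n-t)+t. (n choose i) * (i choose t) * (r choose i))"
    using True by (intro sum.mono_neutral_right) auto
  also have "\<dots> = (\<Sum>m=0..n-t. (n choose (m + t)) * ((m + t) choose t) * (r choose (m + t)))"
    by (rule sum.shift_bounds_cl_nat_ivl)
  also have "\<dots> = (\<Sum>m\<le>n-t. (n choose t) * (((n - t) choose m) * (r choose (t + m))))"
    using True by (intro sum.cong) (auto simp: choose_mult add.commute)
  also have "\<dots> = (n choose t) * ((n - t + r) choose (n - t + t))"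
    unfolding sum_distrib_left[symmetric] sum_binomial_shifted ..
  finally show ?thesis using True assms by simp
next
  case False
  then have "(n choose i) * (i choose t) * (r choose i) = 0" if "i \<le> n" for i
    using that by simp
  then have "(\<Sum>i\<le>n. (n choose i) * (i choose t) * (r choose i)) = 0"
    by (intro sum.neutral) simp
  then show ?thesis using False by (simp only: binomial_eq_0)
qed

text \<open>Gives the coefficient of \<open>c_r\<close> in \<open>c_k\<close> times the inner sum
  over \<open>j\<close>. Trinomial revision and symmetry turn the first two binomials into
  \<open>C(2k,r) C(2k-r,k-j)\<close>, after which Vandermonde applies.\<close>

lemma sum_linearization_coeff_below:
  "(\<Sum>j\<le>k. ((2 * k) choose (j + k)) * linearization_coeff k j r) =
     ((2 * k) choose r) * (r choose k) * ((2 * k) choose k)"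
proof (cases "r \<le> 2 * k")
  case True
  have "((2 * k) choose (j + k)) * ((k + j) choose r) = ((2 * k) choose r) * ((2 * k - r) choose (k - j))"
    if "j \<le> k" for j
  proof (cases "r \<le> k + j")
    case le: True
    then have "((2 * k) choose (j + k)) * ((k + j) choose r) = ((2 * k) choose r) * ((2 * k - r) choose (k + j - r))"
      using that choose_mult[of r "k + j" "2 * k"] by (simp add: add.commute)
    also have "(2 * k - r) choose (k + j - r) = ((2 * k - r) choose (2 * k - r - (k + j - r)))"
      using that by (intro binomial_symmetric) simp
    also have "2 * k - r - (k + j - r) = k - j" using le that by simp
    finally show ?thesis .
  next
    case False
    then have "2 * k - r < k - j" using that True by linarith
    then show ?thesis using False by (simp add: binomial_eq_0)
  qed
  then have "(\<Sum>j\<le>k. ((2 * k) choose (j + k)) * linearization_coeff k j r) =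
      (\<Sum>j\<le>k. ((2 * k) choose r) * (r choose k) * ((r choose j) * ((2 * k - r) choose (k - j))))"
    by (intro sum.cong refl) (simp add: linearization_coeff_def mult_ac)
  also have "\<dots> = ((2 * k) choose r) * (r choose k) * ((r + (2 * k - r)) choose k)"
    unfolding sum_distrib_left[symmetric] vandermonde ..
  finally show ?thesis using True by simp
next
  case False
  then have "linearization_coeff k j r = 0" if "j \<le> k" for j
    using that by (simp add: linearization_coeff_eq_0)
  then show ?thesis using False by simp
qed

text \<open>The coefficient of \<open>c_r(x)\<close> in the square. Splitting
  \<open>C(i+j,r)\<close> by Vandermonde separates \<open>i\<close> from \<open>j\<close>; the two
  sums combine to \<open>c_t(n) c_{r-t}(n)\<close>, and linearizing this at \<open>n\<close> leaves
  one more Vandermonde sum over \<open>t\<close>.\<close>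

lemma sum_linearization_coeff_choose:
  "of_nat (\<Sum>i\<le>n. \<Sum>j\<le>n. (n choose i) * (n choose j) * linearization_coeff i j r) =
    (\<Sum>k\<le>r. of_nat ((r choose k) * ((2 * k) choose r)) * legendre_binomial k (of_nat n :: 'a :: field_char_0))"
proof -
  let ?F = "\<lambda>t. \<Sum>i\<le>n. (n choose i) * (i choose t) * (r choose i)"
  have "(\<Sum>i\<le>n. \<Sum>j\<le>n. (n choose i) * (n choose j) * linearization_coeff i j r) =
      (\<Sum>i\<le>n. \<Sum>j\<le>n. \<Sum>t\<le>r. ((n choose i) * (i choose t) * (r choose i)) * ((n choose j) * (j choose (r - t)) * (r choose j)))"
    unfolding linearization_coeff_def vandermonde[symmetric]
    by (simp add: sum_distrib_left sum_distrib_right mult_ac)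
  also have "\<dots> = (\<Sum>i\<le>n. \<Sum>t\<le>r. ((n choose i) * (i choose t) * (r choose i)) * ?F (r - t))"
    by (subst sum.swap) (simp add: sum_distrib_left)
  also have "\<dots> = (\<Sum>t\<le>r. ?F t * ?F (r - t))"
    by (subst sum.swap) (simp add: sum_distrib_right)
  also have "\<dots> = (\<Sum>t\<le>r. ((n choose t) * ((n + t) choose t)) * ((n choose (r - t)) * ((n + (r - t)) choose (r - t))))"
  proof (intro sum.cong refl)
    fix t assume t: "t \<in> {..r}"
    have sym: "(n + m) choose n = ((n + m) choose m)" for m
      using binomial_symmetric[of n "n + m"] by simp
    \<comment> \<open>Each sum carries the second binomial belonging to the other index, so the
      factors are regrouped crosswise.\<close>
    have "?F t = (n choose t) * ((n + (r - t)) choose n)"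
      "?F (r - t) = (n choose (r - t)) * ((n + t) choose n)"
      using t sum_binomial_three[of t r n] sum_binomial_three[of "r - t" r n] by simp_all
    then show "?F t * ?F (r - t) =
      ((n choose t) * ((n + t) choose t)) * ((n choose (r - t)) * ((n + (r - t)) choose (r - t)))"
      unfolding sym by (simp only: mult_ac)
  qed
  finally have "of_nat (\<Sum>i\<le>n. \<Sum>j\<le>n. (n choose i) * (n choose j) * linearization_coeff i j r) =
     (\<Sum>t\<le>r. legendre_binomial t (of_nat n :: 'a) * legendre_binomial (r - t) (of_nat n))"
    unfolding legendre_binomial_of_nat of_nat_mult[symmetric] of_nat_sum[symmetric] by (rule arg_cong)
  also have "\<dots> = (\<Sum>t\<le>r. \<Sum>k\<le>r. of_nat ((r choose k) * ((k choose t) * (k choose (r - t)))) * legendre_binomial k (of_nat n))"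
    by (intro sum.cong refl) (simp add: legendre_binomial_mult[of _ _ r] linearization_coeff_def mult.assoc)
  also have "\<dots> = (\<Sum>k\<le>r. of_nat ((r choose k) * (\<Sum>t\<le>r. (k choose t) * (k choose (r - t)))) * legendre_binomial k (of_nat n))"
    by (subst sum.swap) (simp add: sum_distrib_left sum_distrib_right mult.assoc)
  finally show ?thesis unfolding vandermonde by (simp add: mult_2)
qed

text \<open>In this form \<open>n\<close> enters a summand only through \<open>C(n+k,2k)\<close>,
  which makes the later weighted sum over \<open>n\<close> telescope.\<close>

lemma s_sum_square:
  fixes x :: "'a :: field_char_0"
  shows "s_sum n x ^ 2 = (\<Sum>k\<le>n. of_nat ((n + k) choose (2 * k)) *
     (legendre_binomial k x * (\<Sum>j\<le>k. of_nat ((2 * k) choose (j + k)) * legendre_binomial j x)))"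
proof -
  let ?c = "\<lambda>r. legendre_binomial r x" and ?d = "\<lambda>r. legendre_binomial r (of_nat n :: 'a)"
  have "s_sum n x ^ 2 = (\<Sum>i\<le>n. \<Sum>j\<le>n. of_nat ((n choose i) * (n choose j)) * (?c i * ?c j))"
    unfolding s_sum_def atLeast0AtMost power2_eq_square sum_product
    by (intro sum.cong refl) (simp add: legendre_binomial_def)
  also have "\<dots> = (\<Sum>i\<le>n. \<Sum>j\<le>n. \<Sum>r\<le>2*n. of_nat ((n choose i) * (n choose j) * linearization_coeff i j r) * ?c r)"
    by (intro sum.cong refl) (simp add: legendre_binomial_mult[of _ _ "2*n"] sum_distrib_left mult.assoc)
  also have "\<dots> = (\<Sum>i\<le>n. \<Sum>r\<le>2*n. \<Sum>j\<le>n. of_nat ((n choose i) * (n choose j) * linearization_coeff i j r) * ?c r)"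
    by (intro sum.cong refl sum.swap)
  also have "\<dots> = (\<Sum>r\<le>2*n. of_nat (\<Sum>i\<le>n. \<Sum>j\<le>n. (n choose i) * (n choose j) * linearization_coeff i j r) * ?c r)"
    by (subst sum.swap) (simp add: sum_distrib_right)
  also have "\<dots> = (\<Sum>r\<le>2*n. (\<Sum>k\<le>n. of_nat ((r choose k) * ((2 * k) choose r)) * ?d k) * ?c r)"
  proof (intro sum.cong refl)
    fix r
    have z: "?d k = 0" if "k > n" for k
      using that by (simp add: legendre_binomial_of_nat)
    \<comment> \<open>The range \<open>k \<le> r\<close> may be replaced by
      \<open>k \<le> n\<close>: \<open>r choose k\<close> vanishes beyond \<open>r\<close>, and
      \<open>?d k\<close> beyond \<open>n\<close>.\<close>
    have "(\<Sum>k\<le>r. of_nat ((r choose k) * ((2 * k) choose r)) * ?d k) =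
        (\<Sum>k\<le>max r n. of_nat ((r choose k) * ((2 * k) choose r)) * ?d k)"
      by (intro sum.mono_neutral_left) auto
    also have "\<dots> = (\<Sum>k\<le>n. of_nat ((r choose k) * ((2 * k) choose r)) * ?d k)"
      by (intro sum.mono_neutral_right) (auto simp: z)
    finally show "of_nat (\<Sum>i\<le>n. \<Sum>j\<le>n. (n choose i) * (n choose j) * linearization_coeff i j r) * ?c r =
      (\<Sum>k\<le>n. of_nat ((r choose k) * ((2 * k) choose r)) * ?d k) * ?c r"
      unfolding sum_linearization_coeff_choose by simp
  qed
  also have "\<dots> = (\<Sum>k\<le>n. \<Sum>r\<le>2*n. of_nat ((r choose k) * ((2 * k) choose r)) * ?d k * ?c r)"
    by (subst sum.swap) (simp add: sum_distrib_right)
  also have "\<dots> = (\<Sum>k\<le>n. of_nat ((n + k) choose (2 * k)) *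
     (?c k * (\<Sum>j\<le>k. of_nat ((2 * k) choose (j + k)) * ?c j)))"
  proof (intro sum.cong refl)
    fix k assume k: "k \<in> {..n}"
    have "?c k * (\<Sum>j\<le>k. of_nat ((2 * k) choose (j + k)) * ?c j) =
       (\<Sum>j\<le>k. \<Sum>r\<le>2*n. of_nat (((2 * k) choose (j + k)) * linearization_coeff k j r) * ?c r)"
      unfolding sum_distrib_left
    proof (intro sum.cong refl)
      fix j assume j: "j \<in> {..k}"
      have "?c k * (of_nat ((2 * k) choose (j + k)) * ?c j) = of_nat ((2 * k) choose (j + k)) * (?c k * ?c j)"
        by simp
      also have "?c k * ?c j = (\<Sum>r\<le>2*n. of_nat (linearization_coeff k j r) * ?c r)"
        using j k by (intro legendre_binomial_mult) auto
      finally show "?c k * (of_nat ((2 * k) choose (j + k)) * ?c j) =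
        (\<Sum>r\<le>2*n. of_nat (((2 * k) choose (j + k)) * linearization_coeff k j r) * ?c r)"
        by (simp add: sum_distrib_left mult.assoc)
    qed
    also have "\<dots> = (\<Sum>r\<le>2*n. of_nat (\<Sum>j\<le>k. ((2 * k) choose (j + k)) * linearization_coeff k j r) * ?c r)"
      by (subst sum.swap) (simp add: sum_distrib_right)
    also have "\<dots> = (\<Sum>r\<le>2*n. of_nat (((2 * k) choose r) * (r choose k) * ((2 * k) choose k)) * ?c r)"
      unfolding sum_linearization_coeff_below ..
    finally have *: "?c k * (\<Sum>j\<le>k. of_nat ((2 * k) choose (j + k)) * ?c j) = \<dots>" .
    \<comment> \<open>The factor \<open>C(2k,k)\<close> of \<open>?d k\<close> is the one produced
      by the expansion \<open>*\<close>; \<open>C(n+k,2k)\<close> remains outside.\<close>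
    have d: "?d k = of_nat ((2 * k) choose k) * of_nat ((n + k) choose (2 * k))"
      by (simp add: legendre_binomial_central binomial_gbinomial)
    show "(\<Sum>r\<le>2*n. of_nat ((r choose k) * ((2 * k) choose r)) * ?d k * ?c r) =
      of_nat ((n + k) choose (2 * k)) * (?c k * (\<Sum>j\<le>k. of_nat ((2 * k) choose (j + k)) * ?c j))"
      unfolding * d sum_distrib_left[of "of_nat ((n + k) choose (2 * k))"]
      by (intro sum.cong refl) (simp add: mult_ac)
  qed
  finally show ?thesis .
qed

section \<open>Integrality of \<open>p\<close>-adic binomial coefficients\<close>

lemma padic_int_unit_of_nat:
  assumes "\<not> CARD('p :: prime_card) dvd m"
  shows "\<exists>y :: 'p padic_int. of_nat m * y = 1"
proof -
  let ?q = "int CARD('p)"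
  have cop: "coprime (int m) (?q ^ n)" for n
    using assms prime_card_int[where 'a='p]
    by (metis coprime_commute coprime_power_right_iff int_dvd_int_iff prime_imp_coprime)
  have "\<exists>a. a \<in> {0..<?q ^ n} \<and> int m * a mod ?q ^ n = 1 mod ?q ^ n" for n
  proof -
    obtain b where "[int m * b = 1] (mod ?q ^ n)"
      using cong_solve_coprime_int[OF cop] by blast
    then show ?thesis
      by (intro exI[of _ "b mod ?q ^ n"]) (simp add: cong_def mod_simps)
  qed
  then obtain f where f: "\<And>n. f n \<in> {0..<?q ^ n}" "\<And>n. int m * f n mod ?q ^ n = 1 mod ?q ^ n"
    by metis
  \<comment> \<open>An inverse of \<open>m\<close> modulo \<open>p^n\<close> is unique in the chosen
    range, so the one modulo \<open>p^(n+1)\<close> reduces to it.\<close>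
  have coh: "f (Suc n) mod ?q ^ n = f n" for n
  proof -
    have "int m * f (Suc n) mod ?q ^ n = 1 mod ?q ^ n"
      using arg_cong[OF f(2)[of "Suc n"], of "\<lambda>a. a mod ?q ^ n"]
      by (simp add: mod_mod_cancel le_imp_power_dvd del: power_Suc)
    then have "[int m * f (Suc n) = int m * f n] (mod ?q ^ n)"
      using f(2)[of n] by (simp add: cong_def)
    then have "[f (Suc n) = f n] (mod ?q ^ n)"
      using cop cong_mult_lcancel by blast
    then show ?thesis using f(1)[of n] by (simp add: cong_def)
  qed
  have res: "padic_residue (Abs_padic_int f :: 'p padic_int) = f"
    using f(1) coh by (intro Abs_padic_int_inverse) auto
  have "of_nat m * (Abs_padic_int f :: 'p padic_int) = 1"
    unfolding padic_residue_inject[symmetric]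
    by (rule ext) (simp add: times_padic_int.rep_eq one_padic_int.rep_eq padic_residue_of_nat res mod_simps f(2))
  then show ?thesis by blast
qed

lemma padic_int_prime_power_dvd:
  fixes x :: "'p :: prime_card padic_int"
  assumes "padic_residue x n = 0"
  shows "of_nat (CARD('p) ^ n) dvd x"
proof -
  let ?q = "int CARD('p)"
  \<comment> \<open>The residues of the quotient are those of \<open>x\<close>, \<open>n\<close>
    places further on, with \<open>p^n\<close> divided out.\<close>
  define f where "f k = padic_residue x (n + k) div ?q ^ n" for k
  have rng: "padic_residue x k \<in> {0..<?q ^ k}" for k
    using padic_residue[of x] by auto
  have qf: "?q ^ n * f k = padic_residue x (n + k)" for k
    using padic_residue_mod[of x n k] assms by (auto simp: f_def dvd_eq_mod_eq_0)
  have "f k \<in> {0..<?q ^ k}" for k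
    using rng[of "n + k"] unfolding qf[symmetric] power_add
    using CARD_prime_power_pos[where 'p='p, of n] by (auto simp: zero_le_mult_iff)
  moreover have "f (Suc k) mod ?q ^ k = f k" for k
  proof -
    have "?q ^ n * (f (Suc k) mod ?q ^ k) = (?q ^ n * f (Suc k)) mod ?q ^ (n + k)"
      by (simp only: power_add mult_mod_right)
    also have "\<dots> = ?q ^ n * f k"
      unfolding qf using padic_residue_mod[of x "n + k" 1] by simp
    finally show ?thesis by simp
  qed
  ultimately have res: "padic_residue (Abs_padic_int f :: 'p padic_int) = f"
    by (intro Abs_padic_int_inverse) auto
  have "x = of_nat (CARD('p) ^ n) * (Abs_padic_int f :: 'p padic_int)"
    unfolding padic_residue_inject[symmetric]
  proof (rule ext)
    fix k
    have "padic_residue x k = ?q ^ n * f k mod ?q ^ k"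
      unfolding qf using padic_residue_mod[of x k n] by (simp add: add.commute)
    then show "padic_residue x k = padic_residue (of_nat (CARD('p) ^ n) * (Abs_padic_int f :: 'p padic_int)) k"
      unfolding times_padic_int.rep_eq padic_residue_of_nat res by (simp add: mod_simps)
  qed
  then show ?thesis by simp
qed

section \<open>The \<open>p\<close>-adic integers inside their fraction field\<close>

abbreviation padic_ints :: "'p :: prime_card padic set" where
  "padic_ints \<equiv> range to_fract"

lemma padic_ints_add: "a \<in> padic_ints \<Longrightarrow> b \<in> padic_ints \<Longrightarrow> a + b \<in> padic_ints"
  by (auto simp flip: to_fract_add)

lemma padic_ints_mult: "a \<in> padic_ints \<Longrightarrow> b \<in> padic_ints \<Longrightarrow> a * b \<in> padic_ints"
  by (auto simp flip: to_fract_mult)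

lemma padic_ints_uminus: "a \<in> padic_ints \<Longrightarrow> - a \<in> padic_ints"
  by (auto simp flip: to_fract_uminus)

lemma padic_ints_diff: "a \<in> padic_ints \<Longrightarrow> b \<in> padic_ints \<Longrightarrow> a - b \<in> padic_ints"
  by (auto simp flip: to_fract_diff)

lemma to_fract_of_nat: "to_fract (of_nat n) = of_nat n"
  by (induction n) simp_all

lemma padic_ints_of_nat: "of_nat n \<in> padic_ints"
  by (metis rangeI to_fract_of_nat)

lemma padic_ints_0: "0 \<in> padic_ints" and padic_ints_1: "1 \<in> padic_ints"
  using padic_ints_of_nat[of 0] padic_ints_of_nat[of 1] by simp_all

lemma padic_ints_power: "a \<in> padic_ints \<Longrightarrow> a ^ n \<in> padic_ints"
  by (induction n) (auto intro: padic_ints_1 padic_ints_mult)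

lemma padic_ints_sum: "(\<And>i. i \<in> I \<Longrightarrow> f i \<in> padic_ints) \<Longrightarrow> sum f I \<in> padic_ints"
  by (induction I rule: infinite_finite_induct) (auto intro: padic_ints_0 padic_ints_add)

lemma padic_ints_divide_of_nat:
  fixes a :: "'p :: prime_card padic"
  assumes "a \<in> padic_ints" and "\<not> CARD('p) dvd m"
  shows "a / of_nat m \<in> padic_ints"
proof -
  obtain y :: "'p padic_int" where "of_nat m * y = 1"
    using padic_int_unit_of_nat[OF assms(2)] by blast
  then have "of_nat m * to_fract y = 1"
    by (metis to_fract_mult to_fract_of_nat to_fract_1)
  then have "a / of_nat m = a * to_fract y"
    by (cases "m = 0") (simp_all add: divide_simps mult_ac)
  then show ?thesis using padic_ints_mult[OF assms(1), of "to_fract y"] by simp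
qed

text \<open>The integrality follows from that for natural numbers, which are dense in the
  \<open>p\<close>-adic integers.\<close>

lemma padic_ints_gbinomial:
  fixes x :: "'p :: prime_card padic"
  assumes "x \<in> padic_ints"
  shows "(x gchoose k) \<in> padic_ints"
proof -
  obtain y :: "'p padic_int" where x: "x = to_fract y" using assms by auto
  \<comment> \<open>Since \<open>m\<close> becomes a unit, only divisibility of the falling
    factorial by \<open>p^v\<close> is at stake.\<close>
  obtain v m where vm: "(fact k :: nat) = CARD('p) ^ v * m" "\<not> CARD('p) dvd m"
    using multiplicity_decompose'[of "fact k :: nat" "CARD('p)"] prime_card[where 'a='p]
    by (metis fact_nonzero not_prime_unit)
  \<comment> \<open>A natural number congruent to \<open>y\<close> modulo
    \<open>p^v\<close>.\<close>
  define n where "n = nat (padic_residue y v)"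
  have n: "int n = padic_residue y v" "int n mod int CARD('p) ^ v = int n"
    using padic_residue[of y] by (auto simp: n_def)
  have d: "of_nat (CARD('p) ^ v) dvd y - of_nat n"
    by (rule padic_int_prime_power_dvd)
      (simp add: minus_padic_int.rep_eq padic_residue_of_nat n(2) flip: n(1))
  have to_fract_prod: "to_fract (\<Prod>i=0..<k. z - of_nat i) = fact k * (to_fract z gchoose k)"
    for z :: "'p padic_int"
    unfolding gbinomial_mult_fact by (induction k) (simp_all add: to_fract_of_nat)
  have "to_fract (\<Prod>i=0..<k. of_nat n - of_nat i :: 'p padic_int) = to_fract (of_nat (fact k * (n choose k)))"
    unfolding to_fract_prod to_fract_of_nat
    by (simp only: to_fract_of_nat of_nat_mult of_nat_fact binomial_gbinomial)
  then have "(\<Prod>i=0..<k. of_nat n - of_nat i :: 'p padic_int) = of_nat (CARD('p) ^ v) * of_nat (m * (n choose k))"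
    unfolding to_fract_eq_iff vm(1) by (simp only: of_nat_mult mult.assoc)
  then have nat: "of_nat (CARD('p) ^ v) dvd (\<Prod>i=0..<k. of_nat n - of_nat i :: 'p padic_int)"
    by simp
  \<comment> \<open>A polynomial with integral coefficients takes congruent values at congruent
    arguments.\<close>
  have diff: "y - of_nat n dvd (\<Prod>i=0..<k. y - of_nat i) - (\<Prod>i=0..<k. of_nat n - of_nat i)"
  proof (induction k)
    case (Suc k)
    have "(\<Prod>i=0..<Suc k. y - of_nat i) - (\<Prod>i=0..<Suc k. of_nat n - of_nat i) =
      ((\<Prod>i=0..<k. y - of_nat i) - (\<Prod>i=0..<k. of_nat n - of_nat i)) * (y - of_nat k) +
      (\<Prod>i=0..<k. of_nat n - of_nat i) * (y - of_nat n)"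
      by (simp add: algebra_simps)
    then show ?case using Suc by (simp only: dvd_add dvd_mult dvd_mult2 dvd_refl)
  qed simp
  have "of_nat (CARD('p) ^ v) dvd (\<Prod>i=0..<k. y - of_nat i)"
    using dvd_add[OF dvd_trans[OF d diff] nat] by simp
  then obtain w where w: "(\<Prod>i=0..<k. y - of_nat i) = of_nat (CARD('p) ^ v) * w"
    by (rule dvdE)
  have "fact k * (x gchoose k) = of_nat (CARD('p) ^ v) * to_fract w"
    unfolding x to_fract_prod[symmetric] w by (simp only: to_fract_mult to_fract_of_nat)
  moreover have "fact k = of_nat (CARD('p) ^ v) * (of_nat m :: 'p padic)"
    unfolding of_nat_mult[symmetric] vm(1)[symmetric] by simp
  ultimately have "of_nat m * (x gchoose k) = to_fract w"
    by simp
  then have "(x gchoose k) = to_fract w / of_nat m"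
    using vm(2) by (cases "m = 0") (simp_all add: field_simps)
  then show ?thesis
    using padic_ints_divide_of_nat[OF _ vm(2)] by auto
qed

section \<open>The congruence\<close>

lemma sum_odd_times_binomial:
  "of_nat (Suc k) * (\<Sum>n<N. of_nat (2 * n + 1) * of_nat ((n + k) choose (2 * k))) =
     of_nat N * (of_nat N - of_nat k) * (of_nat ((N + k) choose (2 * k)) :: 'a :: comm_ring_1)"
proof (induction N)
  case (Suc N)
  let ?b = "of_nat ((N + k) choose (2 * k)) :: 'a"
  \<comment> \<open>The sum telescopes: this turns the closed form at \<open>Suc N\<close> into
    \<open>(N + 1) (N + k + 1) ?b\<close>, and
    \<open>(N + 1) (N + k + 1) - N (N - k) = (k + 1) (2 N + 1)\<close>.\<close>
  have "(of_nat (Suc N) - of_nat k) * of_nat ((Suc N + k) choose (2 * k)) = (of_nat (Suc (N + k)) * ?b :: 'a)"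
    using of_nat_diff_times_binomial_Suc[of "N + k" "2 * k", where 'a='a] by (simp add: algebra_simps)
  then have "of_nat (Suc N) * (of_nat (Suc N) - of_nat k) * of_nat ((Suc N + k) choose (2 * k)) =
      of_nat (Suc N) * (of_nat (Suc (N + k)) * ?b :: 'a)"
    by (simp only: mult.assoc)
  also have "\<dots> = of_nat N * (of_nat N - of_nat k) * ?b + of_nat (Suc k) * (of_nat (2 * N + 1) * ?b)"
    by (simp add: algebra_simps)
  finally show ?case using Suc.IH by (simp add: distrib_left)
qed simp

lemma sum_s_sum_square:
  fixes x :: "'a :: field_char_0"
  assumes "p > 0"
  shows "(\<Sum>n<p. of_nat (2 * n + 1) * s_sum n x ^ 2) =
    of_nat p ^ 2 * (\<Sum>k<p. of_nat (((p - 1) choose k) * ((p + k) choose k)) / of_nat (k + 1) *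
      ((x + of_nat k) gchoose (2 * k)) *
      (\<Sum>j\<le>k. of_nat ((2 * k) choose (j + k)) * legendre_binomial j x))"
proof -
  define G where "G k = (x + of_nat k) gchoose (2 * k)" for k
  define T where "T k = (\<Sum>j\<le>k. of_nat ((2 * k) choose (j + k)) * legendre_binomial j x)" for k
  let ?b = "\<lambda>n k. of_nat ((n + k) choose (2 * k)) :: 'a"
  have "(\<Sum>n<p. of_nat (2 * n + 1) * s_sum n x ^ 2) =
      (\<Sum>n<p. \<Sum>k<p. of_nat (2 * n + 1) * ?b n k * (legendre_binomial k x * T k))"
  proof (intro sum.cong refl)
    fix n assume "n \<in> {..<p}"
    \<comment> \<open>\<open>?b n k\<close> vanishes for \<open>k > n\<close>, so the range can be
      made independent of \<open>n\<close> before the sums are swapped.\<close>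
    then have "s_sum n x ^ 2 = (\<Sum>k<p. ?b n k * (legendre_binomial k x * T k))"
      unfolding s_sum_square T_def[symmetric] by (intro sum.mono_neutral_left) auto
    then show "of_nat (2 * n + 1) * s_sum n x ^ 2 =
      (\<Sum>k<p. of_nat (2 * n + 1) * ?b n k * (legendre_binomial k x * T k))"
      by (simp only: sum_distrib_left mult.assoc)
  qed
  also have "\<dots> = (\<Sum>k<p. (\<Sum>n<p. of_nat (2 * n + 1) * ?b n k) * (legendre_binomial k x * T k))"
    by (subst sum.swap) (simp only: sum_distrib_right)
  also have "\<dots> = (\<Sum>k<p. of_nat p ^ 2 * (of_nat (((p - 1) choose k) * ((p + k) choose k)) / of_nat (k + 1) * G k * T k))"
  proof (intro sum.cong refl)
    fix k assume "k \<in> {..<p}"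
    have "legendre_binomial k (of_nat p :: 'a) = of_nat ((2 * k) choose k) * ?b p k"
      by (simp add: legendre_binomial_central binomial_gbinomial)
    then have "of_nat ((2 * k) choose k) * ?b p k = of_nat ((p choose k) * ((p + k) choose k))"
      by (simp only: legendre_binomial_of_nat)
    \<comment> \<open>Supplies the second factor \<open>p\<close>; the first is already present in
      the telescoped sum.\<close>
    moreover have "(of_nat p - of_nat k) * of_nat (p choose k) = (of_nat p * of_nat ((p - 1) choose k) :: 'a)"
      using of_nat_diff_times_binomial_Suc[of "p - 1" k, where 'a='a] assms by simp
    ultimately have "of_nat p * (of_nat p - of_nat k) * ?b p k * of_nat ((2 * k) choose k) =
        of_nat p ^ 2 * of_nat (((p - 1) choose k) * ((p + k) choose k))"
      by (simp add: power2_eq_square mult_ac)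
    then have "of_nat (k + 1) * ((\<Sum>n<p. of_nat (2 * n + 1) * ?b n k) * of_nat ((2 * k) choose k)) =
        of_nat p ^ 2 * of_nat (((p - 1) choose k) * ((p + k) choose k))"
      using sum_odd_times_binomial[of k p, where 'a='a] by (simp only: Suc_eq_plus1 mult.assoc[symmetric])
    moreover have "of_nat (k + 1) \<noteq> (0 :: 'a)"
      unfolding of_nat_eq_0_iff by simp
    ultimately have "(\<Sum>n<p. of_nat (2 * n + 1) * ?b n k) * of_nat ((2 * k) choose k) =
        of_nat p ^ 2 * (of_nat (((p - 1) choose k) * ((p + k) choose k)) / of_nat (k + 1))"
      unfolding times_divide_eq_right by (intro eq_divide_imp) (simp_all only: mult_ac not_False_eq_True)
    then show "(\<Sum>n<p. of_nat (2 * n + 1) * ?b n k) * (legendre_binomial k x * T k) =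
        of_nat p ^ 2 * (of_nat (((p - 1) choose k) * ((p + k) choose k)) / of_nat (k + 1) * G k * T k)"
      unfolding legendre_binomial_central G_def[symmetric] by (simp only: mult.assoc[symmetric])
  qed
  finally show ?thesis unfolding G_def T_def by (simp only: sum_distrib_left)
qed

text \<open>The signed product is \<open>\<Prod>(1 - p^2/i^2)\<close> over
  \<open>1 \<le> i \<le> k\<close>, where every \<open>i\<close> is a unit. Dividing by
  \<open>p^2\<close> in the field expresses the congruence as integrality.\<close>

lemma signed_binomial_product_cong_1:
  fixes p k :: nat
  assumes p: "p = CARD('p :: prime_card)" and "k < p"
  shows "((- 1) ^ k * of_nat (((p - 1) choose k) * ((p + k) choose k)) - 1) / of_nat p ^ 2
    \<in> (padic_ints :: 'p padic set)"
  using \<open>k < p\<close>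
proof (induction k)
  case 0
  then show ?case by (simp add: padic_ints_0)
next
  case (Suc k)
  define D where "D k = ((- 1) ^ k * of_nat (((p - 1) choose k) * ((p + k) choose k)) :: 'p padic)" for k
  define P K where "P = (of_nat p :: 'p padic)" and "K = (of_nat (Suc k) :: 'p padic)"
  have nz: "P \<noteq> 0" "K \<noteq> 0" using Suc.prems by (simp_all add: P_def K_def del: of_nat_Suc)
  have 1: "K * of_nat ((p - 1) choose Suc k) = (P - K) * of_nat ((p - 1) choose k)"
    using of_nat_Suc_times_binomial[of k "p - 1", where 'a="'p padic"] Suc.prems
    by (simp add: P_def K_def of_nat_diff algebra_simps)
  have "Suc k * ((p + Suc k) choose Suc k) = Suc (p + k) * ((p + k) choose k)"
    using Suc_times_binomial[of k "p + k"] by simp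
  then have 2: "K * of_nat ((p + Suc k) choose Suc k) = (P + K) * of_nat ((p + k) choose k)"
    unfolding P_def K_def of_nat_mult[symmetric] of_nat_add[symmetric] by (simp only: add_Suc_right)
  have "K ^ 2 * D (Suc k) = (- 1) ^ Suc k * (K * of_nat ((p - 1) choose Suc k)) * (K * of_nat ((p + Suc k) choose Suc k))"
    by (simp add: D_def power2_eq_square)
  also have "\<dots> = (K ^ 2 - P ^ 2) * D k"
    unfolding 1 2 by (simp add: D_def algebra_simps power2_eq_square)
  finally have rec: "K ^ 2 * D (Suc k) = (K ^ 2 - P ^ 2) * D k" .
  have "(D (Suc k) - 1) / P ^ 2 = (D k - 1) / P ^ 2 - D k / of_nat (Suc k) / of_nat (Suc k)"
  proof -
    have "D (Suc k) = D k - P ^ 2 * (D k / K / K)"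
      using nz rec by (simp add: field_simps power2_eq_square)
    then show ?thesis
      unfolding K_def[symmetric] using nz by (simp add: diff_divide_distrib)
  qed
  moreover have "\<not> p dvd Suc k" using Suc.prems by (auto dest: dvd_imp_le)
  moreover have "D k \<in> padic_ints"
    unfolding D_def by (intro padic_ints_mult padic_ints_power padic_ints_of_nat padic_ints_uminus padic_ints_1)
  moreover have "(D k - 1) / P ^ 2 \<in> padic_ints"
    using Suc unfolding D_def P_def by simp
  ultimately show ?case
    unfolding D_def[symmetric] P_def[symmetric] using p
    by (simp only: padic_ints_diff padic_ints_divide_of_nat not_False_eq_True)
qed

section \<open>Integrality of the terms\<close>

lemma padic_ints_legendre_binomial: "x \<in> padic_ints \<Longrightarrow> legendre_binomial j x \<in> padic_ints"
  unfolding legendre_binomial_def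
  by (intro padic_ints_mult padic_ints_gbinomial padic_ints_add padic_ints_of_nat)

text \<open>\<open>c_1(x) = x (x + 1)\<close>, and up to index \<open>p - 1\<close> each step of the
  recurrence divides only by squares of units.\<close>

lemma legendre_binomial_factor:
  fixes x :: "'p :: prime_card padic"
  assumes "x \<in> padic_ints" "Suc j < CARD('p)"
  obtains w where "w \<in> padic_ints" "legendre_binomial (Suc j) x = x * (x + 1) * w"
proof -
  have "\<exists>w\<in>padic_ints. legendre_binomial (Suc j) x = x * (x + 1) * w"
    using assms(2)
  proof (induction j)
    case 0
    have "legendre_binomial (Suc 0) x = x * (x + 1) * 1" by (simp add: legendre_binomial_def)
    then show ?case using padic_ints_1 by blast
  next
    case (Suc j)
    then obtain w where w: "w \<in> padic_ints" "legendre_binomial (Suc j) x = x * (x + 1) * w" by auto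
    let ?m = "Suc (Suc j)"
    define v where "v = w * (x * (x + 1) - of_nat (Suc j) * of_nat ?m) / of_nat ?m / of_nat ?m"
    have "\<not> CARD('p) dvd ?m" using Suc.prems by (auto dest: dvd_imp_le)
    then have "v \<in> padic_ints" unfolding v_def using w(1) assms(1)
      by (intro padic_ints_divide_of_nat padic_ints_mult padic_ints_diff padic_ints_add padic_ints_of_nat padic_ints_1)
    moreover have "legendre_binomial ?m x = x * (x + 1) * v"
      using legendre_binomial_Suc[of "Suc j" x] unfolding w(2) v_def
      by (simp add: field_simps power2_eq_square del: of_nat_Suc)
    ultimately show ?case by blast
  qed
  then show ?thesis using that by blast
qed

text \<open>The coefficient is the product of \<open>(p + i) / i\<close> over
  \<open>1 \<le> i \<le> k\<close>, and no numerator is divisible by \<open>p\<close>.\<close>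

lemma prime_not_dvd_add_choose:
  assumes "prime p" "k < p"
  shows "\<not> p dvd ((p + k) choose k)"
  using assms(2)
proof (induction k)
  case 0
  then show ?case using assms(1) by (auto simp: prime_nat_iff)
next
  case (Suc k)
  have "Suc k * ((p + Suc k) choose Suc k) = Suc (p + k) * ((p + k) choose k)"
    using Suc_times_binomial[of k "p + k"] by simp
  moreover have "\<not> p dvd Suc (p + k)"
  proof
    assume "p dvd Suc (p + k)"
    then have "p dvd p + Suc k" by simp
    then have "p dvd Suc k" by (simp only: dvd_add_right_iff dvd_refl)
    then show False using Suc.prems by (auto dest: dvd_imp_le)
  qed
  ultimately show ?case using Suc assms(1)
    by (metis Suc_lessD dvd_mult prime_dvd_mult_iff)
qed

text \<open>
  For \<open>j = 0\<close> the prime divides the central binomial coefficient. For \<open>j > 0\<close> it comes from the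
  factor \<open>x (x+1)\<close> of \<open>c\<^sub>j(x)\<close>: the product \<open>x (x+1) c\<^bsub>p-1\<^esub>(x)\<close> is divisible by \<open>p\<^sup>2\<close>,
  whereas the central binomial coefficient is divisible by \<open>p\<close> only once.
\<close>

lemma last_term_divisible:
  fixes x :: "'p :: prime_card padic"
  assumes x: "x \<in> padic_ints" and p: "CARD('p) = Suc k"
  shows "((x + of_nat k) gchoose (2 * k)) *
    (\<Sum>j\<le>k. of_nat ((2 * k) choose (j + k)) * legendre_binomial j x) / of_nat (Suc k) \<in> padic_ints"
proof -
  define G where "G = (x + of_nat k) gchoose (2 * k)"
  define P where "P = (of_nat (Suc k) :: 'p padic)"
  have P0: "P \<noteq> 0" unfolding P_def by (simp del: of_nat_Suc)
  have prime: "prime (Suc k)" using prime_card[where 'a='p] p by simp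
  have G: "G \<in> padic_ints"
    unfolding G_def by (intro padic_ints_gbinomial padic_ints_add x padic_ints_of_nat)
  \<comment> \<open>\<open>b\<close> is prime to \<open>p\<close>; through \<open>cat\<close> it
    records that \<open>p\<close> divides the central binomial coefficient exactly once.\<close>
  define b where "b = ((Suc k + k) choose k)"
  have b: "\<not> CARD('p) dvd b"
    unfolding b_def p by (rule prime_not_dvd_add_choose[OF prime]) simp
  have "Suc k * b = Suc k * (Suc (2 * k) choose Suc k)"
    using binomial_symmetric[of k "Suc (2 * k)"] by (simp add: b_def mult_2 del: binomial_Suc_Suc)
  also have "\<dots> = Suc (2 * k) * ((2 * k) choose k)"
    by (rule Suc_times_binomial)
  finally have cat: "Suc k * b = Suc (2 * k) * ((2 * k) choose k)" .
  have "Suc k dvd ((2 * k) choose k)"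
  proof -
    have "\<not> Suc k dvd Suc (2 * k)"
    proof
      assume "Suc k dvd Suc (2 * k)"
      then have "Suc k dvd Suc k + k" by (simp add: mult_2)
      then have "Suc k dvd k" by (simp only: dvd_add_right_iff dvd_refl)
      then show False using prime by (cases k) (auto dest: dvd_imp_le)
    qed
    then show ?thesis using cat prime by (metis dvd_triv_left prime_dvd_mult_iff)
  qed
  then obtain a where a: "(2 * k) choose k = Suc k * a" ..
  \<comment> \<open>The factors \<open>x + 1\<close> and \<open>x\<close> complete the two binomials
    of \<open>c_k(x)\<close> to ones of lower index \<open>p\<close>, each at the cost of a factor
    \<open>p\<close>: thus \<open>x (x + 1) c_k(x) = P ^ 2 * M\<close>.\<close>
  define M where "M = ((x + 1) gchoose Suc k) * ((x + of_nat k) gchoose Suc k)"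
  have M: "M \<in> padic_ints"
    unfolding M_def by (intro padic_ints_mult padic_ints_gbinomial padic_ints_add x padic_ints_of_nat padic_ints_1)
  have "P * ((x + of_nat k) gchoose Suc k) = x * ((x + of_nat k) gchoose k)"
    using gbinomial_mult_1[of "x + of_nat k" k] by (simp add: P_def algebra_simps)
  moreover have "P * ((x + 1) gchoose Suc k) = (x + 1) * (x gchoose k)"
    using gbinomial_absorption[of k "x + 1"] by (simp add: P_def)
  moreover have "P ^ 2 * M = (P * ((x + 1) gchoose Suc k)) * (P * ((x + of_nat k) gchoose Suc k))"
    by (simp only: M_def power2_eq_square mult_ac)
  ultimately have "P ^ 2 * M = x * (x + 1) * legendre_binomial k x"
    by (simp only: legendre_binomial_def mult_ac)
  then have "P ^ 2 * M * of_nat (Suc (2 * k)) = of_nat (Suc (2 * k) * ((2 * k) choose k)) * (x * (x + 1) * G)"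
    unfolding legendre_binomial_central G_def by (simp only: of_nat_mult mult_ac)
  then have "P * (P * M * of_nat (Suc (2 * k))) = P * (of_nat b * (x * (x + 1) * G))"
    unfolding cat[symmetric] P_def by (simp only: of_nat_mult power2_eq_square mult_ac)
  then have "P * M * of_nat (Suc (2 * k)) = of_nat b * (x * (x + 1) * G)"
    using P0 by simp
  moreover have "(of_nat b :: 'p padic) \<noteq> 0" using b by (cases "b = 0") auto
  \<comment> \<open>With \<open>c_k(x) = C(2k,k) G\<close>, one of the two factors \<open>p\<close>
    cancels against \<open>C(2k,k)\<close> and one survives, since \<open>b\<close> is a
    unit.\<close>
  ultimately have uG: "x * (x + 1) * G = P * (M * of_nat (Suc (2 * k)) / of_nat b)"
    by (simp add: field_simps)
  have "G * (of_nat ((2 * k) choose (j + k)) * legendre_binomial j x) / P \<in> padic_ints" if "j \<le> k" for j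
  proof (cases j)
    case 0
    have "G * (of_nat ((2 * k) choose (j + k)) * legendre_binomial j x) / P = G * of_nat a"
    proof -
      have "G * (of_nat ((2 * k) choose (j + k)) * legendre_binomial j x) = P * (G * of_nat a)"
        unfolding 0 P_def add_0 a of_nat_mult legendre_binomial_0 mult_1_right
        by (rule mult.left_commute)
      then show ?thesis using P0 by (simp only: nonzero_mult_div_cancel_left not_False_eq_True)
    qed
    then show ?thesis using G by (simp add: padic_ints_mult padic_ints_of_nat)
  next
    case (Suc i)
    then have "Suc i < CARD('p)" using that p by simp
    then obtain w where w: "w \<in> padic_ints" "legendre_binomial j x = x * (x + 1) * w"
      unfolding Suc by (rule legendre_binomial_factor[OF x])
    have "G * (of_nat ((2 * k) choose (j + k)) * legendre_binomial j x) / P =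
        (x * (x + 1) * G) * (of_nat ((2 * k) choose (j + k)) * w) / P"
      unfolding w(2) by (simp only: mult_ac)
    also have "\<dots> = M * of_nat (Suc (2 * k)) / of_nat b * (of_nat ((2 * k) choose (j + k)) * w)"
      unfolding uG using P0 by simp
    also have "\<dots> \<in> padic_ints"
      by (intro padic_ints_mult padic_ints_divide_of_nat M w padic_ints_of_nat b)
    finally show ?thesis .
  qed
  then show ?thesis
    unfolding G_def[symmetric] P_def[symmetric] sum_distrib_left sum_divide_distrib
    by (intro padic_ints_sum) simp
qed

theorem theorem5p1:
  fixes p :: nat and x :: "'p :: prime_card padic"
  assumes "p = CARD('p)" and "x \<in> range to_fract"
  shows "padic_cong
    (\<Sum>k=0..p - 1. of_nat (2 * k + 1) * s_sum k x ^ 2)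
    (of_nat p ^ 2 * (\<Sum>k=0..p - 1. (- 1) ^ k / of_nat (k + 1) * ((x + of_nat k) gchoose (2 * k)) *
       (\<Sum>j=0..k. of_nat ((2 * k) choose (j + k)) * (x gchoose j) * ((x + of_nat j) gchoose j))))
    (p ^ 4)"
proof -
  define A where "A k = ((x + of_nat k) gchoose (2 * k)) *
    (\<Sum>j\<le>k. of_nat ((2 * k) choose (j + k)) * legendre_binomial j x)" for k
  define D where "D k = (of_nat (((p - 1) choose k) * ((p + k) choose k)) :: 'p padic)" for k
  define P where "P = (of_nat p :: 'p padic)"
  have p0: "p > 0" using prime_card[where 'a='p] assms(1) by (simp add: prime_gt_0_nat)
  have P0: "P \<noteq> 0" using p0 by (simp add: P_def)
  have ivl: "{0..p - 1} = {..<p}" using p0 by auto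
  have lhs: "(\<Sum>k=0..p - 1. of_nat (2 * k + 1) * s_sum k x ^ 2) =
      P ^ 2 * (\<Sum>k<p. D k * (A k / of_nat (k + 1)))"
    unfolding ivl sum_s_sum_square[OF p0] P_def D_def A_def
    by (simp only: times_divide_eq_right times_divide_eq_left mult.assoc)
  have rhs: "(\<Sum>k=0..p - 1. (- 1) ^ k / of_nat (k + 1) * ((x + of_nat k) gchoose (2 * k)) *
       (\<Sum>j=0..k. of_nat ((2 * k) choose (j + k)) * (x gchoose j) * ((x + of_nat j) gchoose j))) =
      (\<Sum>k<p. (- 1) ^ k * (A k / of_nat (k + 1)))"
    unfolding ivl
    unfolding A_def legendre_binomial_def atLeast0AtMost
    by (simp only: times_divide_eq_right times_divide_eq_left mult.assoc)
  \<comment> \<open>The integral quotient in \<open>(-1)^k D k = 1 + p^2 E k\<close>; as the sign is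
    its own inverse, \<open>DE\<close> moves it to the other side.\<close>
  define E where "E k = ((- 1) ^ k * D k - 1) / P ^ 2" for k
  have E: "E k \<in> padic_ints" if "k < p" for k
    using signed_binomial_product_cong_1[OF assms(1) that] by (simp only: E_def D_def P_def)
  have DE: "D k - (- 1) ^ k = P ^ 2 * ((- 1) ^ k * E k)" for k
  proof -
    have "P ^ 2 * ((- 1) ^ k * E k) = (- 1) ^ k * ((- 1) ^ k * D k - 1)"
      using P0 by (simp add: E_def)
    also have "\<dots> = ((- 1) ^ k * (- 1) ^ k) * D k - (- 1) ^ k"
      by (simp add: algebra_simps)
    also have "(- 1) ^ k * (- 1) ^ k = (1 :: 'p padic)"
      by (simp flip: power_mult_distrib)
    finally show ?thesis by simp
  qed
  \<comment> \<open>As \<open>k + 1 \<le> p\<close>, the denominator is divisible by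
    \<open>p\<close> only at \<open>k = p - 1\<close>.\<close>
  have "A k / of_nat (k + 1) \<in> padic_ints" if "k < p" for k
  proof (cases "Suc k = p")
    case True
    then show ?thesis using last_term_divisible[OF assms(2), of k] assms(1) by (simp add: A_def)
  next
    case False
    then have "\<not> p dvd k + 1" using that by (auto dest: dvd_imp_le)
    then show ?thesis unfolding A_def using assms
      by (intro padic_ints_divide_of_nat padic_ints_mult padic_ints_sum padic_ints_gbinomial
          padic_ints_add padic_ints_of_nat padic_ints_legendre_binomial) auto
  qed
  then have "(\<Sum>k<p. (- 1) ^ k * E k * (A k / of_nat (k + 1))) \<in> padic_ints"
    by (intro padic_ints_sum padic_ints_mult padic_ints_power padic_ints_uminus padic_ints_1 E) auto
  then obtain z where z: "(\<Sum>k<p. (- 1) ^ k * E k * (A k / of_nat (k + 1))) = to_fract z" by blast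
  \<comment> \<open>One \<open>P ^ 2\<close> stands in front of both sums and the other comes from
    \<open>DE\<close>, which together give \<open>p ^ 4\<close>.\<close>
  have "P ^ 2 * (\<Sum>k<p. D k * (A k / of_nat (k + 1))) - P ^ 2 * (\<Sum>k<p. (- 1) ^ k * (A k / of_nat (k + 1))) =
      P ^ 2 * (\<Sum>k<p. (D k - (- 1) ^ k) * (A k / of_nat (k + 1)))"
    by (simp only: right_diff_distrib left_diff_distrib sum_subtractf)
  also have "\<dots> = P ^ 2 * (P ^ 2 * to_fract z)"
    unfolding DE z[symmetric] sum_distrib_left by (simp only: mult.assoc)
  also have "\<dots> = of_nat (p ^ 4) * to_fract z"
    by (simp add: P_def power2_eq_square power4_eq_xxxx mult.assoc)
  finally show ?thesis
    unfolding padic_cong_def lhs rhs P_def[symmetric] by blast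
qed

end
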